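(* Let $X,\mathcal B,\sigma,R,h,\lambda,\mathbb P$ and the unitary operator $U$ on $\mathbf L_2({\rm Sol}_\sigma(X),\mathcal F,\mathbb P)$ be as described in the context. Let $\mathcal H_0=\{f\circ\pi_0:\ f\in\mathbf L_2(X,h\,d\lambda)\}$ and $\mathcal H_n=U^{-n}\mathcal H_0$. Then, for $n=0,1,\ldots$, $$\mathcal H_n=\mathbf L_2({\rm Sol}_\sigma(X),\mathcal F_n,\mathbb P)=\mathbb E_{\mathcal F_n}\big(\mathbf L_2({\rm Sol}_\sigma(X),\mathcal F,\mathbb P)\big).$$
   Context: $X$ is a locally compact Hausdorff space with Borel sigma-algebra $\mathcal B$, $\sigma:X\to X$ is measurable and onto, and $\mathcal M(X,\mathcal B)$ is the space of real-valued measurable functions on $X$. $R$ is a $\sigma$-transfer operator, that is, a map from $\mathcal M(X,\mathcal B)$ into itself which is positive ($f\ge0\Rightarrow Rf\ge0$) and satisfies the pull-out property $R((f\circ\sigma)g)=fR(g)$ for all $f,g$. $\lambda$ is a probability measure on $(X,\mathcal B)$, and $h\ge0$ is a measurable function with $Rh=h$ and $\int_Xh\,d\lambda=1$. The measure $\lambda R$, defined by $\int_Xf\,d(\lambda R)=\int_XR(f)\,d\lambda$, is assumed absolutely continuous with respect to $\lambda$, with Radon-Nikodym derivative $W=d(\lambda R)/d\lambda$. The solenoid is ${\rm Sol}_\sigma(X)=\{(x_k)_{k\ge0}\in X^{\mathbb N_0}:\sigma(x_{k+1})=x_k,\ k\ge0\}$, $\pi_k(x_0,x_1,\ldots)=x_k$,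 $\mathcal F$ is the cylinder sigma-algebra on ${\rm Sol}_\sigma(X)$, and $\mathcal F_n=\pi_n^{-1}(\mathcal B)$. $\mathbb P$ is the unique probability measure on $({\rm Sol}_\sigma(X),\mathcal F)$ with $$\int(f_0\circ\pi_0)(f_1\circ\pi_1)\cdots(f_n\circ\pi_n)\,d\mathbb P=\int_Xf_0R(f_1R(f_2\cdots R(f_nh)\cdots))\,d\lambda$$ for all $n\in\mathbb N_0$ and $f_0,\ldots,f_n\in\mathcal M(X,\mathcal B)$ (for which the integrals make sense). The laws $\mu_0$ and $\mu_1$ of $\pi_0$ and $\pi_1$ under $\mathbb P$ are assumed equivalent (mutually absolutely continuous). The bijection $\widehat\sigma$ of ${\rm Sol}_\sigma(X)$ is $\widehat\sigma(x_0,x_1,\ldots)=(\sigma(x_0),x_0,x_1,\ldots)$, and $U\psi=\sqrt{W\circ\pi_0}\,(\psi\circ\widehat\sigma)$, which is a unitary operator from $\mathbf L_2({\rm Sol}_\sigma(X),\mathcal F,\mathbb P)$ onto itself. $\mathbb E_{\mathcal F_n}$ is the conditional expectation onto $\mathcal F_n$, that is, the orthogonal projection of $\mathbf L_2({\rm Sol}_\sigma(X),\mathcal F,\mathbb P)$ onto $\mathbf L_2({\rm Sol}_\sigma(X),\mathcal F_n,\mathbb P)$. *)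

theory Defs
  imports "HOL-Probability.Probability"
begin

section \<open>The solenoid\<close>

definition solenoid :: "('a \<Rightarrow> 'a) \<Rightarrow> (nat \<Rightarrow> 'a) set" where
  "solenoid \<sigma> = {x. \<forall>k. \<sigma> (x (Suc k)) = x k}"

text \<open>The cylinder sigma-algebra is the one generated by all coordinate maps; as usual, a
  sigma-algebra is represented by a measure space of which only the space and the measurable
  sets matter.\<close>

definition cylinder_algebra :: "('a :: topological_space \<Rightarrow> 'a) \<Rightarrow> (nat \<Rightarrow> 'a) measure" where
  "cylinder_algebra \<sigma> =
     sigma (solenoid \<sigma>) {(\<lambda>x. x k) -` A \<inter> solenoid \<sigma> | k A. A \<in> sets borel}"

definition coord_algebra :: "('a :: topological_space \<Rightarrow> 'a) \<Rightarrow> nat \<Rightarrow> (nat \<Rightarrow> 'a) measure" where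
  "coord_algebra \<sigma> n = vimage_algebra (solenoid \<sigma>) (\<lambda>x. x n) borel"

definition sol_map :: "('a \<Rightarrow> 'a) \<Rightarrow> (nat \<Rightarrow> 'a) \<Rightarrow> (nat \<Rightarrow> 'a)" where
  "sol_map \<sigma> x = case_nat (\<sigma> (x 0)) x"


section \<open>Transfer operators\<close>

text \<open>The space \<open>M(X, B)\<close> of measurable functions is \<open>borel_measurable borel\<close>; the values of
  \<open>R\<close> on nonmeasurable functions are irrelevant.\<close>

definition transfer_operator ::
    "('a :: topological_space \<Rightarrow> 'a) \<Rightarrow> (('a \<Rightarrow> real) \<Rightarrow> ('a \<Rightarrow> real)) \<Rightarrow> bool" where
  "transfer_operator \<sigma> R \<longleftrightarrow>
     (\<forall>f \<in> borel_measurable borel. R f \<in> borel_measurable borel) \<and>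
     (\<forall>f \<in> borel_measurable borel. (\<forall>x. 0 \<le> f x) \<longrightarrow> (\<forall>x. 0 \<le> R f x)) \<and>
     (\<forall>f \<in> borel_measurable borel. \<forall>g \<in> borel_measurable borel.
        R (\<lambda>x. f (\<sigma> x) * g x) = (\<lambda>x. f x * R g x))"

text \<open>\<open>\<nu>\<close> is the measure \<open>\<lambda>R\<close>. The defining identity is required for nonnegative
  functions, where both sides always make sense in \<open>[0, \<infinity>]\<close>; this determines \<open>\<nu>\<close>.\<close>

definition is_measure_transfer ::
    "'a :: topological_space measure \<Rightarrow> (('a \<Rightarrow> real) \<Rightarrow> ('a \<Rightarrow> real)) \<Rightarrow> 'a measure \<Rightarrow> bool" where
  "is_measure_transfer lam R \<nu> \<longleftrightarrow>
     sets \<nu> = sets borel \<and>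
     (\<forall>f \<in> borel_measurable borel. (\<forall>x. 0 \<le> f x) \<longrightarrow>
        (\<integral>\<^sup>+x. ennreal (f x) \<partial>\<nu>) = (\<integral>\<^sup>+x. ennreal (R f x) \<partial>lam))"

text \<open>\<open>nested R h n f\<close> is \<open>f\<^sub>0 R(f\<^sub>1 R(\<dots> R(f\<^sub>n h) \<dots>))\<close>.\<close>

primrec nested ::
    "(('a \<Rightarrow> real) \<Rightarrow> ('a \<Rightarrow> real)) \<Rightarrow> ('a \<Rightarrow> real) \<Rightarrow> nat \<Rightarrow> (nat \<Rightarrow> 'a \<Rightarrow> real) \<Rightarrow> 'a \<Rightarrow> real" where
  "nested R h 0 f = (\<lambda>x. f 0 x * h x)"
| "nested R h (Suc n) f = (\<lambda>x. f 0 x * R (nested R h n (\<lambda>k. f (Suc k))) x)"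

text \<open>Again the identity is required for nonnegative functions, where all integrals exist in
  \<open>[0, \<infinity>]\<close>. It determines \<open>P\<close>, since finite intersections of sets \<open>\<pi>\<^sub>k\<^sup>-\<^sup>1(A)\<close>
  generate the cylinder sigma-algebra.\<close>

definition is_solenoid_measure ::
    "('a :: topological_space \<Rightarrow> 'a) \<Rightarrow> (('a \<Rightarrow> real) \<Rightarrow> ('a \<Rightarrow> real)) \<Rightarrow> ('a \<Rightarrow> real) \<Rightarrow>
      'a measure \<Rightarrow> (nat \<Rightarrow> 'a) measure \<Rightarrow> bool" where
  "is_solenoid_measure \<sigma> R h lam P \<longleftrightarrow>
     prob_space P \<and> space P = solenoid \<sigma> \<and> sets P = sets (cylinder_algebra \<sigma>) \<and>
     (\<forall>n f. (\<forall>k\<le>n. f k \<in> borel_measurable borel \<and> (\<forall>x. 0 \<le> f k x)) \<longrightarrow>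
        (\<integral>\<^sup>+x. ennreal (\<Prod>k\<le>n. f k (x k)) \<partial>P) = (\<integral>\<^sup>+x. ennreal (nested R h n f x) \<partial>lam))"


section \<open>Real \<open>L\<^sub>2\<close> spaces of classes of functions\<close>

definition square_integrable :: "'s measure \<Rightarrow> ('s \<Rightarrow> real) set" where
  "square_integrable M = {f \<in> borel_measurable M. integrable M (\<lambda>x. (f x)\<^sup>2)}"

definition ae_class :: "'s measure \<Rightarrow> ('s \<Rightarrow> real) \<Rightarrow> ('s \<Rightarrow> real) set" where
  "ae_class M f = {g \<in> borel_measurable M. AE x in M. g x = f x}"

definition L2 :: "'s measure \<Rightarrow> ('s \<Rightarrow> real) set set" where
  "L2 M = ae_class M ` square_integrable M"

text \<open>For a sub-sigma-algebra \<open>G\<close> of \<open>M\<close>, the space of square-integrable \<open>G\<close>-measurable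
  functions, seen as a subspace of \<open>L2 M\<close>: the classes are taken among the \<open>M\<close>-measurable
  functions.\<close>

definition L2_sub :: "'s measure \<Rightarrow> 's measure \<Rightarrow> ('s \<Rightarrow> real) set set" where
  "L2_sub M G = ae_class M ` square_integrable (restr_to_subalg M G)"

text \<open>Conditional expectation acting on classes; the lemmas below show that it is well defined
  and is the orthogonal projection of \<open>L2 M\<close> onto \<open>L2_sub M G\<close>.\<close>

definition cond_exp_L2 :: "'s measure \<Rightarrow> 's measure \<Rightarrow> ('s \<Rightarrow> real) set \<Rightarrow> ('s \<Rightarrow> real) set" where
  "cond_exp_L2 M G C = (\<Union>\<psi>\<in>C. ae_class M (real_cond_exp M G \<psi>))"

lemma ae_class_eqI:
  assumes "AE x in M. f x = g x"
  shows "ae_class M f = ae_class M g"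
proof -
  have "(AE x in M. k x = f x) = (AE x in M. k x = g x)" for k
  proof (rule eventually_subst)
    show "AE x in M. (k x = f x) = (k x = g x)"
      using assms by (rule eventually_mono) simp
  qed
  then show ?thesis unfolding ae_class_def by simp
qed

lemma square_integrable_integrable:
  assumes "finite_measure M" "f \<in> square_integrable M"
  shows "integrable M f"
proof -
  have "f \<in> borel_measurable M" "integrable M (\<lambda>x. (f x)\<^sup>2)"
    using assms(2) unfolding square_integrable_def by blast+
  then show ?thesis
    using finite_measure.square_integrable_imp_integrable[OF assms(1)] by blast
qed

lemma square_integrable_times:
  assumes "f \<in> square_integrable M" "g \<in> square_integrable M"
  shows "integrable M (\<lambda>x. f x * g x)"
proof (rule Bochner_Integration.integrable_bound)
  show "integrable M (\<lambda>x. (f x)\<^sup>2 + (g x)\<^sup>2)"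
    using assms by (auto simp: square_integrable_def)
  show "(\<lambda>x. f x * g x) \<in> borel_measurable M"
    using assms by (auto simp: square_integrable_def)
  have "\<bar>a * b\<bar> \<le> a\<^sup>2 + b\<^sup>2" for a b :: real
  proof -
    have "0 \<le> \<bar>a\<bar> * \<bar>b\<bar>" by simp
    then show ?thesis
      using sum_squares_bound[of "\<bar>a\<bar>" "\<bar>b\<bar>"] unfolding abs_mult power2_abs by linarith
  qed
  then show "AE x in M. norm (f x * g x) \<le> norm ((f x)\<^sup>2 + (g x)\<^sup>2)"
    by (simp add: abs_of_nonneg)
qed

lemma cond_exp_L2_ae_class:
  assumes "finite_measure_subalgebra M G" "\<psi> \<in> square_integrable M"
  shows "cond_exp_L2 M G (ae_class M \<psi>) = ae_class M (real_cond_exp M G \<psi>)"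
proof -
  interpret finite_measure_subalgebra M G by fact
  have [measurable]: "\<psi> \<in> borel_measurable M"
    using assms(2) by (simp add: square_integrable_def)
  have eq: "ae_class M (real_cond_exp M G \<phi>) = ae_class M (real_cond_exp M G \<psi>)"
    if "\<phi> \<in> ae_class M \<psi>" for \<phi>
  proof (rule ae_class_eqI, rule real_cond_exp_cong)
    show "AE x in M. \<phi> x = \<psi> x" and "\<phi> \<in> borel_measurable M" and "\<psi> \<in> borel_measurable M"
      using that assms(2) by (simp_all add: ae_class_def square_integrable_def)
  qed
  have "\<psi> \<in> ae_class M \<psi>" by (simp add: ae_class_def)
  then have "ae_class M \<psi> \<noteq> {}" by blast
  then show ?thesis
    unfolding cond_exp_L2_def using eq by (rule SUP_eq_const)
qed

lemma real_cond_exp_square_integrable: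
  assumes "finite_measure_subalgebra M G" "\<psi> \<in> square_integrable M"
  shows "real_cond_exp M G \<psi> \<in> square_integrable (restr_to_subalg M G)"
proof -
  interpret finite_measure_subalgebra M G by fact
  have m [measurable]: "\<psi> \<in> borel_measurable M" and i: "integrable M (\<lambda>x. (\<psi> x)\<^sup>2)"
    using assms(2) by (auto simp: square_integrable_def)
  have "integrable M \<psi>"
    using assms(2) finite_measure_axioms by (rule square_integrable_integrable[rotated])
  then have "integrable M (\<lambda>x. (real_cond_exp M G \<psi> x)\<^sup>2)"
    using i by (intro integrable_convex_cond_exp[where I = UNIV and q = "\<lambda>t. t\<^sup>2"])
      (auto simp: convex_power_even)
  then have "integrable (restr_to_subalg M G) (\<lambda>x. (real_cond_exp M G \<psi> x)\<^sup>2)"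
    by (intro integrable_in_subalg subalg) auto
  then show ?thesis
    using measurable_in_subalg[OF subalg borel_measurable_cond_exp]
    by (simp add: square_integrable_def)
qed

lemma real_cond_exp_orthogonal:
  assumes "finite_measure_subalgebra M G" "\<psi> \<in> square_integrable M"
    and "\<phi> \<in> square_integrable (restr_to_subalg M G)"
  shows "(\<integral>x. (\<psi> x - real_cond_exp M G \<psi> x) * \<phi> x \<partial>M) = 0"
proof -
  interpret finite_measure_subalgebra M G by fact
  have mG: "\<phi> \<in> borel_measurable G"
    using assms(3) measurable_in_subalg'[OF subalg] by (auto simp: square_integrable_def)
  moreover have "integrable M (\<lambda>x. (\<phi> x)\<^sup>2)"
    using assms(3) integrable_from_subalg[OF subalg] by (auto simp: square_integrable_def)
  ultimately have "\<phi> \<in> square_integrable M"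
    using measurable_from_subalg[OF subalg] by (auto simp: square_integrable_def)
  then have i: "integrable M (\<lambda>x. \<phi> x * \<psi> x)"
    using assms(2) by (rule square_integrable_times)
  have "\<psi> \<in> borel_measurable M"
    using assms(2) by (simp add: square_integrable_def)
  note * = real_cond_exp_intg[OF i mG this]
  have "(\<integral>x. (\<psi> x - real_cond_exp M G \<psi> x) * \<phi> x \<partial>M)
      = (\<integral>x. \<phi> x * \<psi> x - \<phi> x * real_cond_exp M G \<psi> x \<partial>M)"
    by (simp add: algebra_simps)
  also have "\<dots> = 0"
    using i * by (subst Bochner_Integration.integral_diff) auto
  finally show ?thesis .
qed


section \<open>The operator \<open>U\<close> and the spaces \<open>H\<^sub>n\<close>\<close>

text \<open>\<open>U\<close> acts on classes by acting on all representatives.\<close>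

definition sol_U ::
    "('a \<Rightarrow> 'a) \<Rightarrow> ('a \<Rightarrow> real) \<Rightarrow> (nat \<Rightarrow> 'a) measure \<Rightarrow>
      ((nat \<Rightarrow> 'a) \<Rightarrow> real) set \<Rightarrow> ((nat \<Rightarrow> 'a) \<Rightarrow> real) set" where
  "sol_U \<sigma> W P C = (\<Union>\<psi>\<in>C. ae_class P (\<lambda>x. sqrt (W (x 0)) * \<psi> (sol_map \<sigma> x)))"

definition sol_H0 ::
    "('a \<Rightarrow> real) \<Rightarrow> 'a measure \<Rightarrow> (nat \<Rightarrow> 'a) measure \<Rightarrow> ((nat \<Rightarrow> 'a) \<Rightarrow> real) set set" where
  "sol_H0 h lam P =
     (\<lambda>f. ae_class P (\<lambda>x. f (x 0))) ` square_integrable (density lam (\<lambda>x. ennreal (h x)))"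

text \<open>\<open>H\<^sub>n = U\<^sup>-\<^sup>n H\<^sub>0\<close>, where \<open>U\<^sup>-\<^sup>1\<close> is the inverse of the bijection \<open>U\<close> of \<open>L2 P\<close>.\<close>

definition sol_H ::
    "('a \<Rightarrow> 'a) \<Rightarrow> ('a \<Rightarrow> real) \<Rightarrow> ('a \<Rightarrow> real) \<Rightarrow> 'a measure \<Rightarrow> (nat \<Rightarrow> 'a) measure \<Rightarrow> nat \<Rightarrow>
      ((nat \<Rightarrow> 'a) \<Rightarrow> real) set set" where
  "sol_H \<sigma> W h lam P n = (inv_into (L2 P) (sol_U \<sigma> W P) ^^ n) ` sol_H0 h lam P"

end

theory Submission
  imports Defs
begin

text \<open>The measure \<open>P\<close> is invariant under \<^term>\<open>sol_map \<sigma>\<close> up to the weight \<open>W(x\<^sub>0)\<close>: the law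
  of \<open>x\<^sub>m\<^sub>+\<^sub>1\<close> is obtained from that of \<open>x\<^sub>m\<close> by one more application of \<open>R\<close> under the integral
  against \<open>\<lambda>\<close>, and this amounts to the density \<open>W\<close>
  (\<open>solenoid_measure_coord_law\<close>, \<open>solenoid_measure_invariant\<close>). The equivalence of the laws of \<open>x\<^sub>0\<close>
  and \<open>x\<^sub>1\<close> makes the weight positive almost everywhere (\<open>solenoid_measure_weight_pos\<close>). So \<open>U\<close> is
  an isometric bijection of the square-integrable classes, and its inverse is explicit: it shifts a
  function by one coordinate and divides it by \<open>sqrt (W(x\<^sub>1))\<close> (\<open>inv_sol_U_ae_class\<close>).

  A function measurable for the \<open>n\<close>-th coordinate sigma-algebra is a function \<open>f(x\<^sub>n)\<close>
  (\<open>L2_sub_coordE\<close>), and \<open>U\<^sup>-\<^sup>1\<close> sends it to \<open>f(x\<^sub>n\<^sub>+\<^sub>1) / sqrt (W(x\<^sub>1))\<close>. Since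
  \<open>x\<^sub>1 = \<sigma>\<^sup>n(x\<^sub>n\<^sub>+\<^sub>1)\<close> along the solenoid, this depends on \<open>x\<^sub>n\<^sub>+\<^sub>1\<close> alone, and every class of level
  \<open>n + 1\<close> arises in this way (\<open>inv_sol_U_L2_sub\<close>). Level \<open>0\<close> is the space that the iteration starts
  from, because \<open>h d\<lambda>\<close> is the law of \<open>x\<^sub>0\<close>; induction on \<open>n\<close> gives the first equality. The second one
  holds for any sub-sigma-algebra: the conditional expectation takes values in its \<open>L\<^sub>2\<close> space and
  fixes that space (\<open>cond_exp_L2_image\<close>).\<close>

section \<open>Coordinates on the solenoid\<close>

lemma solenoid_coord:
  assumes "x \<in> solenoid \<sigma>" shows "x k = (\<sigma> ^^ m) (x (m + k))"
proof (induction m)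
  case (Suc m)
  have "\<sigma> (x (Suc (m + k))) = x (m + k)"
    using assms by (simp add: solenoid_def)
  with Suc show ?case
    unfolding funpow_Suc_right by simp
qed simp

lemma sol_map_in_solenoid: "x \<in> solenoid \<sigma> \<Longrightarrow> sol_map \<sigma> x \<in> solenoid \<sigma>"
  by (auto simp: solenoid_def sol_map_def split: nat.split)

lemma sol_map_0: "sol_map \<sigma> x 0 = \<sigma> (x 0)"
  and sol_map_Suc: "sol_map \<sigma> x (Suc k) = x k"
  by (simp_all add: sol_map_def)

lemma shift_in_solenoid: "x \<in> solenoid \<sigma> \<Longrightarrow> (\<lambda>k. x (Suc k)) \<in> solenoid \<sigma>"
  by (auto simp: solenoid_def)

lemma shift_sol_map: "(\<lambda>k. sol_map \<sigma> x (Suc k)) = x"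
  by (simp add: sol_map_Suc)

text \<open>A point \<open>y\<close> at position \<open>n\<close> determines the entries before it by applying \<open>\<sigma>\<close>; the later
  entries are chosen with a right inverse of \<open>\<sigma>\<close>.\<close>

lemma coord_surj:
  assumes "surj \<sigma>" shows "(\<lambda>x. x n) ` solenoid \<sigma> = UNIV"
proof -
  have "\<exists>x \<in> solenoid \<sigma>. y = x n" for y
  proof -
    let ?x = "\<lambda>k. if k \<le> n then (\<sigma> ^^ (n - k)) y else (inv \<sigma> ^^ (k - n)) y"
    have "\<sigma> (?x (Suc k)) = ?x k" for k
    proof (cases "Suc k \<le> n")
      case True
      then have "n - k = Suc (n - Suc k)" by simp
      with True show ?thesis by simp
    next
      case False
      then have "Suc k - n = Suc (k - n)" by simp
      with False show ?thesis
        by (cases "k = n") (simp_all add: surj_f_inv_f[OF assms])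
    qed
    then have x: "?x \<in> solenoid \<sigma>" by (simp add: solenoid_def)
    show ?thesis by (rule bexI[of _ ?x, OF _ x]) simp
  qed
  then show ?thesis by auto
qed

lemma measurable_coord: "(\<lambda>x. x k) \<in> cylinder_algebra \<sigma> \<rightarrow>\<^sub>M borel"
proof (rule measurableI)
  fix A :: "'a set" assume "A \<in> sets borel"
  then show "(\<lambda>x. x k) -` A \<inter> space (cylinder_algebra \<sigma>) \<in> sets (cylinder_algebra \<sigma>)"
    unfolding cylinder_algebra_def
    by (subst space_measure_of, blast, subst sets_measure_of) (blast, blast intro: sigma_sets.Basic)
qed simp

lemma space_cylinder_algebra: "space (cylinder_algebra \<sigma>) = solenoid \<sigma>"
  unfolding cylinder_algebra_def by (rule space_measure_of) blast

lemma measurable_into_cylinder_algebra: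
  assumes "\<And>k. (\<lambda>x. f x k) \<in> M \<rightarrow>\<^sub>M borel" and "f \<in> space M \<rightarrow> solenoid \<sigma>"
  shows "f \<in> M \<rightarrow>\<^sub>M cylinder_algebra \<sigma>"
  unfolding cylinder_algebra_def
proof (rule measurable_measure_of)
  fix C assume "C \<in> {(\<lambda>x. x k) -` A \<inter> solenoid \<sigma> | k A. A \<in> sets borel}"
  then obtain k A where C: "C = (\<lambda>x. x k) -` A \<inter> solenoid \<sigma>" and A: "A \<in> sets borel"
    by blast
  have "f -` C \<inter> space M = (\<lambda>x. f x k) -` A \<inter> space M"
    using assms(2) by (auto simp: C)
  then show "f -` C \<inter> space M \<in> sets M"
    using measurable_sets[OF assms(1) A] by simp
qed (use assms(2) in blast)+

lemma measurable_sol_map: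
  assumes "\<sigma> \<in> borel \<rightarrow>\<^sub>M borel"
  shows "sol_map \<sigma> \<in> cylinder_algebra \<sigma> \<rightarrow>\<^sub>M cylinder_algebra \<sigma>"
proof (rule measurable_into_cylinder_algebra)
  show "(\<lambda>x. sol_map \<sigma> x k) \<in> cylinder_algebra \<sigma> \<rightarrow>\<^sub>M borel" for k
    using measurable_coord[of _ \<sigma>] measurable_compose[OF measurable_coord assms]
    by (cases k) (simp_all add: sol_map_0 sol_map_Suc)
qed (auto simp: space_cylinder_algebra sol_map_in_solenoid)

text \<open>Along the solenoid, each coordinate is a function of any later one. Hence the one-coordinate
  cylinders, without finite intersections, are already stable under intersection, and a finite
  measure is determined by its values on them.\<close>

lemma cylinder_measure_eqI:
  assumes \<sigma> [measurable]: "\<sigma> \<in> borel \<rightarrow>\<^sub>M borel"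
    and M: "sets M = sets (cylinder_algebra \<sigma>)" and N: "sets N = sets (cylinder_algebra \<sigma>)"
    and "finite_measure M"
    and eq: "\<And>k A. A \<in> sets borel \<Longrightarrow>
      emeasure M ((\<lambda>x. x k) -` A \<inter> solenoid \<sigma>) = emeasure N ((\<lambda>x. x k) -` A \<inter> solenoid \<sigma>)"
  shows "M = N"
proof (rule measure_eqI_generator_eq)
  let ?E = "{(\<lambda>x. x k) -` A \<inter> solenoid \<sigma> | k A. A \<in> sets borel}"
  have *: "(\<lambda>x. x j) -` A \<inter> solenoid \<sigma> \<inter> ((\<lambda>x. x k) -` B \<inter> solenoid \<sigma>) \<in> ?E"
    if le: "j \<le> k" and [measurable]: "A \<in> sets borel" "B \<in> sets borel" for j k A B
  proof -
    have "x j = (\<sigma> ^^ (k - j)) (x k)" if "x \<in> solenoid \<sigma>" for x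
      using solenoid_coord[OF that, of j "k - j"] le by simp
    then have "(\<lambda>x. x j) -` A \<inter> solenoid \<sigma> \<inter> ((\<lambda>x. x k) -` B \<inter> solenoid \<sigma>)
        = (\<lambda>x. x k) -` ((\<sigma> ^^ (k - j)) -` A \<inter> B) \<inter> solenoid \<sigma>"
      by auto
    moreover have "(\<sigma> ^^ (k - j)) -` A \<inter> B \<in> sets borel"
      using measurable_sets[OF measurable_compose_n[OF \<sigma>, of "k - j"], of A] by simp
    ultimately show ?thesis by blast
  qed
  show "Int_stable ?E"
  proof (rule Int_stableI)
    fix C D assume "C \<in> ?E" "D \<in> ?E"
    then obtain j A k B where
      CD: "C = (\<lambda>x. x j) -` A \<inter> solenoid \<sigma>" "D = (\<lambda>x. x k) -` B \<inter> solenoid \<sigma>"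
        "A \<in> sets borel" "B \<in> sets borel"
      by blast
    show "C \<inter> D \<in> ?E"
    proof (cases "j \<le> k")
      case True
      then show ?thesis using *[OF True CD(3,4)] by (simp only: CD)
    next
      case False
      then have "k \<le> j" by simp
      from *[OF this CD(4,3)] show ?thesis by (simp only: CD Int_commute)
    qed
  qed
  show "sets M = sigma_sets (solenoid \<sigma>) ?E" "sets N = sigma_sets (solenoid \<sigma>) ?E"
    unfolding M N cylinder_algebra_def by (rule sets_measure_of, blast)+
  show "emeasure M C = emeasure N C" if "C \<in> ?E" for C
  proof -
    from that obtain k A where "C = (\<lambda>x. x k) -` A \<inter> solenoid \<sigma>" "A \<in> sets borel"
      by blast
    then show ?thesis using eq[of A k] by simp
  qed
  have "\<exists>k A. solenoid \<sigma> = (\<lambda>x. x k) -` A \<inter> solenoid \<sigma> \<and> A \<in> sets borel"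
    by (intro exI[of _ 0] exI[of _ UNIV]) simp
  then show "range (\<lambda>_ :: nat. solenoid \<sigma>) \<subseteq> ?E" by (simp add: image_subset_iff)
  show "emeasure M (solenoid \<sigma>) \<noteq> \<infinity>" for i :: nat
    using \<open>finite_measure M\<close> by (simp add: finite_measure.emeasure_finite)
  show "?E \<subseteq> Pow (solenoid \<sigma>)" by blast
  show "(\<Union>i :: nat. solenoid \<sigma>) = solenoid \<sigma>" by simp
qed


section \<open>Classes of functions\<close>

lemma ae_class_eq_iff:
  assumes "f \<in> borel_measurable M"
  shows "ae_class M f = ae_class M g \<longleftrightarrow> (AE x in M. f x = g x)"
proof
  assume "ae_class M f = ae_class M g"
  moreover have "f \<in> ae_class M f" using assms by (simp add: ae_class_def)
  ultimately show "AE x in M. f x = g x" by (simp add: ae_class_def)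
qed (rule ae_class_eqI)

lemma square_integrable_cong:
  assumes "\<And>x. x \<in> space M \<Longrightarrow> f x = g x"
  shows "f \<in> square_integrable M \<longleftrightarrow> g \<in> square_integrable M"
proof -
  have "f \<in> borel_measurable M \<longleftrightarrow> g \<in> borel_measurable M"
    using assms by (rule measurable_cong)
  moreover have "integrable M (\<lambda>x. (f x)\<^sup>2) \<longleftrightarrow> integrable M (\<lambda>x. (g x)\<^sup>2)"
    by (rule Bochner_Integration.integrable_cong) (simp_all add: assms)
  ultimately show ?thesis
    by (simp add: square_integrable_def)
qed

lemma square_integrable_restr_iff:
  assumes "subalgebra M G"
  shows "f \<in> square_integrable (restr_to_subalg M G) \<longleftrightarrow>
    f \<in> borel_measurable G \<and> integrable M (\<lambda>x. (f x)\<^sup>2)"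
proof -
  have "integrable (restr_to_subalg M G) (\<lambda>x. (f x)\<^sup>2) \<longleftrightarrow> integrable M (\<lambda>x. (f x)\<^sup>2)"
    if [measurable]: "f \<in> borel_measurable G"
  proof
    have "(\<lambda>x. (f x)\<^sup>2) \<in> borel_measurable G" by measurable
    then show "integrable (restr_to_subalg M G) (\<lambda>x. (f x)\<^sup>2)" if "integrable M (\<lambda>x. (f x)\<^sup>2)"
      using that by (rule integrable_in_subalg[OF assms])
  qed (rule integrable_from_subalg[OF assms])
  then show ?thesis
    using measurable_in_subalg[OF assms] measurable_in_subalg'[OF assms]
    by (auto simp: square_integrable_def)
qed

text \<open>The conditional expectation fixes the classes of \<open>G\<close>-measurable functions, so it maps onto
  \<^term>\<open>L2_sub M G\<close>.\<close>

lemma cond_exp_L2_image: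
  assumes "finite_measure_subalgebra M G"
  shows "cond_exp_L2 M G ` L2 M = L2_sub M G"
proof
  interpret finite_measure_subalgebra M G by fact
  show "cond_exp_L2 M G ` L2 M \<subseteq> L2_sub M G"
    using real_cond_exp_square_integrable[OF assms]
    by (auto simp: L2_def L2_sub_def cond_exp_L2_ae_class[OF assms])
  show "L2_sub M G \<subseteq> cond_exp_L2 M G ` L2 M"
  proof
    fix C assume "C \<in> L2_sub M G"
    then obtain \<phi> where \<phi>: "C = ae_class M \<phi>" "\<phi> \<in> borel_measurable G"
        "integrable M (\<lambda>x. (\<phi> x)\<^sup>2)"
      by (auto simp: L2_sub_def square_integrable_restr_iff[OF subalg])
    then have sq: "\<phi> \<in> square_integrable M"
      using measurable_from_subalg[OF subalg] by (auto simp: square_integrable_def)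
    have "integrable M \<phi>"
      using finite_measure_axioms sq by (rule square_integrable_integrable)
    then have "AE x in M. real_cond_exp M G \<phi> x = \<phi> x"
      using \<phi>(2) by (rule real_cond_exp_F_meas)
    then have "cond_exp_L2 M G (ae_class M \<phi>) = C"
      unfolding cond_exp_L2_ae_class[OF assms sq] \<phi>(1) by (rule ae_class_eqI)
    with sq show "C \<in> cond_exp_L2 M G ` L2 M"
      by (auto simp: L2_def)
  qed
qed

text \<open>A function measurable for the sigma-algebra generated by \<open>p\<close> is constant on the fibres of
  \<open>p\<close>, because the preimage of the point \<open>g x\<close> is a union of fibres; so it can be read off at one
  chosen point of each fibre.\<close>

lemma borel_measurable_vimage_algebra_factor:
  fixes g :: "'a \<Rightarrow> 'c :: t1_space"
  assumes g: "g \<in> borel_measurable (vimage_algebra \<Omega> p N)"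
    and surj: "p ` \<Omega> = space N"
  obtains f where "f \<in> borel_measurable N" "\<And>x. x \<in> \<Omega> \<Longrightarrow> g x = f (p x)"
proof
  have preimage: "\<exists>B \<in> sets N. g -` A \<inter> \<Omega> = p -` B \<inter> \<Omega>" if "A \<in> sets borel" for A
  proof -
    have "g -` A \<inter> \<Omega> \<in> sets (vimage_algebra \<Omega> p N)"
      using measurable_sets[OF g that] by simp
    moreover have "p \<in> \<Omega> \<rightarrow> space N"
      using surj by blast
    ultimately show ?thesis
      by (auto simp: sets_vimage_algebra2)
  qed
  have fibre: "g x = g y" if "x \<in> \<Omega>" "y \<in> \<Omega>" "p x = p y" for x y
  proof -
    obtain B where B: "g -` {g x} \<inter> \<Omega> = p -` B \<inter> \<Omega>"
      using preimage[of "{g x}"] by auto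
    have "x \<in> g -` {g x} \<inter> \<Omega>" using that by simp
    then have "y \<in> p -` B \<inter> \<Omega>" using that unfolding B by simp
    then show ?thesis unfolding B[symmetric] by simp
  qed
  let ?f = "\<lambda>y. g (inv_into \<Omega> p y)"
  show gf: "g x = ?f (p x)" if "x \<in> \<Omega>" for x
    using that by (intro fibre) (auto intro: inv_into_into simp: f_inv_into_f)
  show "?f \<in> borel_measurable N"
  proof (rule measurableI)
    fix A :: "'c set" assume "A \<in> sets borel"
    then obtain B where B: "B \<in> sets N" "g -` A \<inter> \<Omega> = p -` B \<inter> \<Omega>"
      using preimage by blast
    have "y \<in> ?f -` A \<inter> space N \<longleftrightarrow> y \<in> B" for y
    proof (cases "y \<in> space N")
      case True
      then obtain x where x: "x \<in> \<Omega>" "y = p x" using surj by blast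
      then have "y \<in> B \<longleftrightarrow> x \<in> g -` A \<inter> \<Omega>" unfolding B(2) by simp
      with True x gf[OF x(1)] show ?thesis by simp
    next
      case False
      with B(1) sets.sets_into_space show ?thesis by blast
    qed
    then have "?f -` A \<inter> space N = B" by blast
    with B(1) show "?f -` A \<inter> space N \<in> sets N" by simp
  qed simp
qed


section \<open>The weighted shift\<close>

text \<open>What the level-by-level argument needs from \<open>P\<close>: a positive weight at the first coordinate which
  turns \<^term>\<open>sol_map \<sigma>\<close> into a map that preserves \<open>P\<close>.\<close>

locale weighted_shift = prob_space P
  for P :: "(nat \<Rightarrow> 'a :: t2_space) measure" +
  fixes \<sigma> :: "'a \<Rightarrow> 'a" and W :: "'a \<Rightarrow> real"
  assumes \<sigma>: "\<sigma> \<in> borel \<rightarrow>\<^sub>M borel" and surj: "surj \<sigma>"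
    and W: "W \<in> borel_measurable borel" and W_nonneg: "\<And>x. 0 \<le> W x"
    and sets_P: "sets P = sets (cylinder_algebra \<sigma>)"
    and invariant: "distr (density P (\<lambda>x. ennreal (W (x 0)))) P (sol_map \<sigma>) = P"
    and W_pos: "AE x in P. 0 < W (x 0)"
begin

lemma space_P: "space P = solenoid \<sigma>"
  using sets_eq_imp_space_eq[OF sets_P] by (simp add: space_cylinder_algebra)

lemma coord [measurable]: "(\<lambda>x. x k) \<in> P \<rightarrow>\<^sub>M borel"
  using measurable_coord measurable_cong_sets[OF sets_P refl] by blast

lemmas \<sigma>_W_measurable [measurable] = \<sigma> W

lemma sol_map_measurable [measurable]: "sol_map \<sigma> \<in> P \<rightarrow>\<^sub>M P"
  using measurable_sol_map[OF \<sigma>] measurable_cong_sets[OF sets_P sets_P] by blast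

lemma shift_measurable [measurable]: "(\<lambda>x k. x (Suc k)) \<in> P \<rightarrow>\<^sub>M P"
proof -
  have "(\<lambda>x k. x (Suc k)) \<in> P \<rightarrow>\<^sub>M cylinder_algebra \<sigma>"
    by (intro measurable_into_cylinder_algebra) (auto simp: space_P shift_in_solenoid)
  then show ?thesis
    using measurable_cong_sets[OF refl sets_P] by blast
qed

lemma nn_integral_sol_map:
  assumes [measurable]: "F \<in> borel_measurable P"
  shows "(\<integral>\<^sup>+x. F x \<partial>P) = (\<integral>\<^sup>+x. ennreal (W (x 0)) * F (sol_map \<sigma> x) \<partial>P)"
proof -
  have "(\<integral>\<^sup>+x. F x \<partial>P) = (\<integral>\<^sup>+x. F x \<partial>distr (density P (\<lambda>x. ennreal (W (x 0)))) P (sol_map \<sigma>))"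
    by (simp only: invariant)
  also have "\<dots> = (\<integral>\<^sup>+x. F (sol_map \<sigma> x) \<partial>density P (\<lambda>x. ennreal (W (x 0))))"
    by (rule nn_integral_distr) measurable
  also have "\<dots> = (\<integral>\<^sup>+x. ennreal (W (x 0)) * F (sol_map \<sigma> x) \<partial>P)"
    by (rule nn_integral_density) measurable
  finally show ?thesis .
qed

text \<open>Since the weight is positive almost everywhere, \<^term>\<open>sol_map \<sigma>\<close> preserves and reflects null
  sets.\<close>

lemma AE_sol_map_iff:
  assumes [measurable]: "Measurable.pred P Q"
  shows "(AE x in P. Q (sol_map \<sigma> x)) \<longleftrightarrow> (AE x in P. Q x)"
proof -
  have "(AE x in P. Q x) \<longleftrightarrow>
      (AE x in distr (density P (\<lambda>x. ennreal (W (x 0)))) P (sol_map \<sigma>). Q x)"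
    by (simp only: invariant)
  also have "\<dots> \<longleftrightarrow> (AE x in density P (\<lambda>x. ennreal (W (x 0))). Q (sol_map \<sigma> x))"
    by (rule AE_distr_iff) measurable
  also have "\<dots> \<longleftrightarrow> (AE x in P. 0 < ennreal (W (x 0)) \<longrightarrow> Q (sol_map \<sigma> x))"
    by (rule AE_density) measurable
  also have "\<dots> \<longleftrightarrow> (AE x in P. Q (sol_map \<sigma> x))"
    by (rule eventually_subst) (use W_pos in \<open>auto elim: eventually_mono\<close>)
  finally show ?thesis by simp
qed

text \<open>These are \<open>U\<close> and its inverse on functions. The inverse divides by the weight at \<open>x\<^sub>1\<close>, because
  the weight at the first coordinate of the shifted point is the one that \<open>U\<close> multiplied by.\<close>

definition weighted_sol_map :: "((nat \<Rightarrow> 'a) \<Rightarrow> real) \<Rightarrow> (nat \<Rightarrow> 'a) \<Rightarrow> real" where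
  "weighted_sol_map \<psi> x = sqrt (W (x 0)) * \<psi> (sol_map \<sigma> x)"

definition weighted_sol_map_inv :: "((nat \<Rightarrow> 'a) \<Rightarrow> real) \<Rightarrow> (nat \<Rightarrow> 'a) \<Rightarrow> real" where
  "weighted_sol_map_inv \<phi> x = \<phi> (\<lambda>k. x (Suc k)) / sqrt (W (x 1))"

lemma weighted_measurable [measurable]:
  assumes [measurable]: "\<psi> \<in> borel_measurable P"
  shows "weighted_sol_map \<psi> \<in> borel_measurable P"
    and "weighted_sol_map_inv \<psi> \<in> borel_measurable P"
  unfolding weighted_sol_map_def weighted_sol_map_inv_def by measurable

lemma square_integrable_iff_finite:
  assumes [measurable]: "\<psi> \<in> borel_measurable P"
  shows "\<psi> \<in> square_integrable P \<longleftrightarrow> (\<integral>\<^sup>+x. ennreal ((\<psi> x)\<^sup>2) \<partial>P) < \<infinity>"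
  by (simp add: square_integrable_def integrable_iff_bounded)

text \<open>The weight \<open>W(x\<^sub>0)\<close> in the invariance of \<open>P\<close> is the square of the factor in \<open>U\<close>, so \<open>U\<close> preserves
  the square integral.\<close>

lemma weighted_sol_map_square_integrable:
  assumes [measurable]: "\<psi> \<in> borel_measurable P"
  shows "weighted_sol_map \<psi> \<in> square_integrable P \<longleftrightarrow> \<psi> \<in> square_integrable P"
proof -
  have "(\<integral>\<^sup>+x. ennreal ((\<psi> x)\<^sup>2) \<partial>P) = (\<integral>\<^sup>+x. ennreal ((weighted_sol_map \<psi> x)\<^sup>2) \<partial>P)"
    by (subst nn_integral_sol_map)
      (auto simp: weighted_sol_map_def power_mult_distrib ennreal_mult W_nonneg)
  then show ?thesis by (simp add: square_integrable_iff_finite)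
qed

lemma weighted_sol_map_inverse:
  "AE x in P. weighted_sol_map (weighted_sol_map_inv \<phi>) x = \<phi> x"
  using W_pos
  by eventually_elim
    (simp add: weighted_sol_map_def weighted_sol_map_inv_def shift_sol_map sol_map_Suc[where k = 0, simplified])

text \<open>Read from right to left, this makes \<open>U\<close> well defined on classes; from left to right, it makes
  it injective.\<close>

lemma weighted_sol_map_cancel:
  assumes [measurable]: "\<psi> \<in> borel_measurable P" "\<phi> \<in> borel_measurable P"
  shows "(AE x in P. weighted_sol_map \<psi> x = weighted_sol_map \<phi> x) \<longleftrightarrow> (AE x in P. \<psi> x = \<phi> x)"
proof -
  have "(AE x in P. weighted_sol_map \<psi> x = weighted_sol_map \<phi> x)
      \<longleftrightarrow> (AE x in P. \<psi> (sol_map \<sigma> x) = \<phi> (sol_map \<sigma> x))"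
    by (rule eventually_subst)
      (use W_pos in \<open>auto simp: weighted_sol_map_def elim: eventually_mono\<close>)
  also have "\<dots> \<longleftrightarrow> (AE x in P. \<psi> x = \<phi> x)"
    by (rule AE_sol_map_iff) (simp add: pred_def)
  finally show ?thesis .
qed

lemma weighted_sol_map_inv_square_integrable:
  assumes "\<phi> \<in> square_integrable P"
  shows "weighted_sol_map_inv \<phi> \<in> square_integrable P"
proof -
  have [measurable]: "\<phi> \<in> borel_measurable P" and "integrable P (\<lambda>x. (\<phi> x)\<^sup>2)"
    using assms by (auto simp: square_integrable_def)
  moreover have "AE x in P. (\<phi> x)\<^sup>2 = (weighted_sol_map (weighted_sol_map_inv \<phi>) x)\<^sup>2"
    using weighted_sol_map_inverse[of \<phi>] by eventually_elim simp
  ultimately have "weighted_sol_map (weighted_sol_map_inv \<phi>) \<in> square_integrable P"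
    by (auto simp: square_integrable_def elim!: integrable_cong_AE_imp)
  then show ?thesis
    by (simp add: weighted_sol_map_square_integrable)
qed

lemma sol_U_ae_class:
  assumes [measurable]: "\<psi> \<in> borel_measurable P"
  shows "sol_U \<sigma> W P (ae_class P \<psi>) = ae_class P (weighted_sol_map \<psi>)"
proof -
  have "sol_U \<sigma> W P (ae_class P \<psi>) = (\<Union>\<phi>\<in>ae_class P \<psi>. ae_class P (weighted_sol_map \<phi>))"
    by (simp add: sol_U_def weighted_sol_map_def[abs_def])
  also have "\<dots> = ae_class P (weighted_sol_map \<psi>)"
  proof (rule SUP_eq_const)
    have "\<psi> \<in> ae_class P \<psi>"
      by (simp add: ae_class_def)
    then show "ae_class P \<psi> \<noteq> {}" by blast
    show "ae_class P (weighted_sol_map \<phi>) = ae_class P (weighted_sol_map \<psi>)"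
      if "\<phi> \<in> ae_class P \<psi>" for \<phi>
      using that by (intro ae_class_eqI) (auto simp: ae_class_def weighted_sol_map_cancel)
  qed
  finally show ?thesis .
qed

text \<open>Injectivity is what lets \<^const>\<open>inv_into\<close> be evaluated: any square-integrable preimage under
  \<open>U\<close> is the preimage.\<close>

lemma inj_on_sol_U: "inj_on (sol_U \<sigma> W P) (L2 P)"
proof (rule inj_onI)
  fix C D assume "C \<in> L2 P" "D \<in> L2 P" and eq: "sol_U \<sigma> W P C = sol_U \<sigma> W P D"
  then obtain \<psi> \<phi> where CD: "C = ae_class P \<psi>" "D = ae_class P \<phi>"
    and [measurable]: "\<psi> \<in> borel_measurable P" "\<phi> \<in> borel_measurable P"
    by (auto simp: L2_def square_integrable_def)
  from eq have "AE x in P. weighted_sol_map \<psi> x = weighted_sol_map \<phi> x"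
    by (simp add: CD sol_U_ae_class ae_class_eq_iff)
  then show "C = D"
    by (simp add: CD weighted_sol_map_cancel ae_class_eqI)
qed

lemma inv_sol_U_ae_class:
  assumes "\<phi> \<in> square_integrable P"
  shows "inv_into (L2 P) (sol_U \<sigma> W P) (ae_class P \<phi>) = ae_class P (weighted_sol_map_inv \<phi>)"
proof (rule inv_into_f_eq[OF inj_on_sol_U])
  show "ae_class P (weighted_sol_map_inv \<phi>) \<in> L2 P"
    using weighted_sol_map_inv_square_integrable[OF assms] by (simp add: L2_def)
  have [measurable]: "\<phi> \<in> borel_measurable P"
    using assms by (simp add: square_integrable_def)
  show "sol_U \<sigma> W P (ae_class P (weighted_sol_map_inv \<phi>)) = ae_class P \<phi>"
    using weighted_sol_map_inverse by (simp add: sol_U_ae_class ae_class_eqI)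
qed


section \<open>The levels of the filtration\<close>

lemma subalgebra_coord_algebra: "subalgebra P (coord_algebra \<sigma> n)"
  unfolding subalgebra_def
proof
  show "space (coord_algebra \<sigma> n) = space P"
    by (simp add: coord_algebra_def space_P)
  show "sets (coord_algebra \<sigma> n) \<subseteq> sets P"
  proof
    fix C assume "C \<in> sets (coord_algebra \<sigma> n)"
    then obtain A where "C = (\<lambda>x. x n) -` A \<inter> space P" "A \<in> sets borel"
      unfolding coord_algebra_def by (subst (asm) sets_vimage_algebra2) (simp, auto simp: space_P)
    then show "C \<in> sets P"
      using measurable_sets[OF coord] by simp
  qed
qed

lemma finite_subalgebra_coord_algebra: "finite_measure_subalgebra P (coord_algebra \<sigma> n)"
  by (rule finite_measure_subalgebra.intro[OF finite_measure_axioms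
      finite_measure_subalgebra_axioms.intro[OF subalgebra_coord_algebra]])

text \<open>The next two lemmas describe the classes at level \<open>n\<close> by functions \<open>f(x\<^sub>n)\<close> with \<open>f\<close> Borel
  measurable on the base space; all later arguments use only this description.\<close>

lemma L2_sub_coordI:
  assumes f: "f \<in> borel_measurable borel" and sq: "(\<lambda>x. f (x n)) \<in> square_integrable P"
  shows "ae_class P (\<lambda>x. f (x n)) \<in> L2_sub P (coord_algebra \<sigma> n)"
proof -
  have "(\<lambda>x. x n) \<in> coord_algebra \<sigma> n \<rightarrow>\<^sub>M borel"
    unfolding coord_algebra_def by (rule measurable_vimage_algebra1) simp
  from measurable_compose[OF this f]
  have "(\<lambda>x. f (x n)) \<in> borel_measurable (coord_algebra \<sigma> n)" .
  moreover have "integrable P (\<lambda>x. (f (x n))\<^sup>2)"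
    using sq by (simp add: square_integrable_def)
  ultimately have "(\<lambda>x. f (x n)) \<in> square_integrable (restr_to_subalg P (coord_algebra \<sigma> n))"
    by (simp add: square_integrable_restr_iff[OF subalgebra_coord_algebra])
  then show ?thesis
    unfolding L2_sub_def by (rule imageI)
qed

lemma L2_sub_coordE:
  assumes "C \<in> L2_sub P (coord_algebra \<sigma> n)"
  obtains f where "f \<in> borel_measurable borel" "(\<lambda>x. f (x n)) \<in> square_integrable P"
    "C = ae_class P (\<lambda>x. f (x n))"
proof -
  obtain g where C: "C = ae_class P g" and g: "g \<in> borel_measurable (coord_algebra \<sigma> n)"
    and int: "integrable P (\<lambda>x. (g x)\<^sup>2)"
    using assms by (auto simp: L2_sub_def square_integrable_restr_iff[OF subalgebra_coord_algebra])
  have "(\<lambda>x. x n) ` solenoid \<sigma> = space borel"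
    using coord_surj[OF surj] by simp
  from g[unfolded coord_algebra_def] this
  obtain f where f: "f \<in> borel_measurable borel"
    and gf: "\<And>x. x \<in> solenoid \<sigma> \<Longrightarrow> g x = f (x n)"
    by (rule borel_measurable_vimage_algebra_factor) blast
  have "integrable P (\<lambda>x. (f (x n))\<^sup>2) \<longleftrightarrow> integrable P (\<lambda>x. (g x)\<^sup>2)"
    by (rule Bochner_Integration.integrable_cong) (simp_all add: space_P gf)
  with int measurable_compose[OF coord f] have "(\<lambda>x. f (x n)) \<in> square_integrable P"
    by (simp add: square_integrable_def)
  moreover have "C = ae_class P (\<lambda>x. f (x n))"
    unfolding C by (rule ae_class_eqI, rule AE_I2) (simp add: space_P gf)
  ultimately show ?thesis
    by (rule that[OF f])
qed

text \<open>\<open>U\<^sup>-\<^sup>1\<close> turns \<open>f(x\<^sub>n)\<close> into \<open>f(x\<^sub>n\<^sub>+\<^sub>1) / sqrt (W(x\<^sub>1))\<close>, and \<open>U\<close> turns \<open>f(x\<^sub>n\<^sub>+\<^sub>1)\<close> into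
  \<open>sqrt (W(x\<^sub>0)) f(x\<^sub>n)\<close>. The weights stay inside the sigma-algebra of the level, because \<open>x\<^sub>1\<close> is
  \<open>\<sigma>\<^sup>n(x\<^sub>n\<^sub>+\<^sub>1)\<close> and \<open>x\<^sub>0\<close> is \<open>\<sigma>\<^sup>n(x\<^sub>n)\<close>.\<close>

lemma inv_sol_U_L2_sub:
  "inv_into (L2 P) (sol_U \<sigma> W P) ` L2_sub P (coord_algebra \<sigma> n) = L2_sub P (coord_algebra \<sigma> (Suc n))"
proof
  have "(\<lambda>y. W ((\<sigma> ^^ n) y)) \<in> borel_measurable borel"
    by (rule measurable_compose[OF measurable_compose_n[OF \<sigma>] W])
  then have sqrt_W: "(\<lambda>y. sqrt (W ((\<sigma> ^^ n) y))) \<in> borel_measurable borel"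
    by (rule measurable_compose[OF _ borel_measurable_sqrt])
  show "inv_into (L2 P) (sol_U \<sigma> W P) ` L2_sub P (coord_algebra \<sigma> n) \<subseteq> L2_sub P (coord_algebra \<sigma> (Suc n))"
  proof
    fix C assume "C \<in> inv_into (L2 P) (sol_U \<sigma> W P) ` L2_sub P (coord_algebra \<sigma> n)"
    then obtain f where f: "f \<in> borel_measurable borel"
      and sq: "(\<lambda>x. f (x n)) \<in> square_integrable P"
      and C: "C = ae_class P (weighted_sol_map_inv (\<lambda>x. f (x n)))"
      by (auto elim!: L2_sub_coordE simp: inv_sol_U_ae_class)
    let ?g = "\<lambda>y. f y / sqrt (W ((\<sigma> ^^ n) y))"
    have eq: "weighted_sol_map_inv (\<lambda>x. f (x n)) x = ?g (x (Suc n))" if "x \<in> space P" for x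
      using solenoid_coord[of x \<sigma> 1 n] that by (simp add: space_P weighted_sol_map_inv_def)
    have C': "C = ae_class P (\<lambda>x. ?g (x (Suc n)))"
      unfolding C by (intro ae_class_eqI AE_I2 eq)
    have "(\<lambda>x. ?g (x (Suc n))) \<in> square_integrable P"
      by (rule iffD1[OF square_integrable_cong weighted_sol_map_inv_square_integrable[OF sq]]) (rule eq)
    with borel_measurable_divide[OF f sqrt_W] show "C \<in> L2_sub P (coord_algebra \<sigma> (Suc n))"
      unfolding C' by (rule L2_sub_coordI)
  qed
  show "L2_sub P (coord_algebra \<sigma> (Suc n)) \<subseteq> inv_into (L2 P) (sol_U \<sigma> W P) ` L2_sub P (coord_algebra \<sigma> n)"
  proof
    fix C assume "C \<in> L2_sub P (coord_algebra \<sigma> (Suc n))"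
    then obtain f where f: "f \<in> borel_measurable borel"
      and sq: "(\<lambda>x. f (x (Suc n))) \<in> square_integrable P"
      and C: "C = ae_class P (\<lambda>x. f (x (Suc n)))"
      by (rule L2_sub_coordE)
    let ?g = "\<lambda>y. sqrt (W ((\<sigma> ^^ n) y)) * f y"
    have eq: "weighted_sol_map (\<lambda>x. f (x (Suc n))) x = ?g (x n)" if "x \<in> space P" for x
      using solenoid_coord[of x \<sigma> 0 n] that by (simp add: space_P weighted_sol_map_def sol_map_Suc)
    have UC: "sol_U \<sigma> W P C = ae_class P (\<lambda>x. ?g (x n))"
      unfolding C using sq
      by (subst sol_U_ae_class) (simp add: square_integrable_def, intro ae_class_eqI AE_I2 eq)
    have U_sq: "weighted_sol_map (\<lambda>x. f (x (Suc n))) \<in> square_integrable P"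
      using sq by (subst weighted_sol_map_square_integrable) (simp_all add: square_integrable_def)
    have "(\<lambda>x. ?g (x n)) \<in> square_integrable P"
      by (rule iffD1[OF square_integrable_cong U_sq]) (rule eq)
    with borel_measurable_times[OF sqrt_W f] have "sol_U \<sigma> W P C \<in> L2_sub P (coord_algebra \<sigma> n)"
      unfolding UC by (rule L2_sub_coordI)
    moreover have "C = inv_into (L2 P) (sol_U \<sigma> W P) (sol_U \<sigma> W P C)"
      using sq by (subst inv_into_f_f[OF inj_on_sol_U]) (auto simp: C L2_def)
    ultimately show "C \<in> inv_into (L2 P) (sol_U \<sigma> W P) ` L2_sub P (coord_algebra \<sigma> n)"
      by blast
  qed
qed

lemma sol_H0_eq_L2_sub:
  assumes h: "h \<in> borel_measurable borel" and lam: "sets lam = sets borel"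
    and law: "distr P borel (\<lambda>x. x 0) = density lam (\<lambda>x. ennreal (h x))"
  shows "sol_H0 h lam P = L2_sub P (coord_algebra \<sigma> 0)"
proof -
  have iff: "f \<in> square_integrable (density lam (\<lambda>x. ennreal (h x))) \<longleftrightarrow>
      f \<in> borel_measurable borel \<and> (\<lambda>x. f (x 0)) \<in> square_integrable P" for f
  proof (cases "f \<in> borel_measurable borel")
    case True
    then have "(\<lambda>x. (f x)\<^sup>2) \<in> borel_measurable borel"
      by (rule borel_measurable_power)
    from integrable_distr_eq[OF coord this] measurable_compose[OF coord True] True
    show ?thesis
      unfolding law[symmetric] square_integrable_def by simp
  next
    case False
    then show ?thesis
      unfolding law[symmetric] square_integrable_def by simp
  qed
  show ?thesis
  proof
    show "sol_H0 h lam P \<subseteq> L2_sub P (coord_algebra \<sigma> 0)"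
    proof
      fix C assume "C \<in> sol_H0 h lam P"
      then obtain f where f: "f \<in> square_integrable (density lam (\<lambda>x. ennreal (h x)))"
        and C: "C = ae_class P (\<lambda>x. f (x 0))"
        unfolding sol_H0_def by blast
      from f show "C \<in> L2_sub P (coord_algebra \<sigma> 0)"
        unfolding C iff by (blast intro: L2_sub_coordI[where f = f])
    qed
    show "L2_sub P (coord_algebra \<sigma> 0) \<subseteq> sol_H0 h lam P"
    proof
      fix C assume "C \<in> L2_sub P (coord_algebra \<sigma> 0)"
      then obtain f where f: "f \<in> borel_measurable borel" "(\<lambda>x. f (x 0)) \<in> square_integrable P"
        and C: "C = ae_class P (\<lambda>x. f (x 0))"
        by (rule L2_sub_coordE)
      from f show "C \<in> sol_H0 h lam P"
        unfolding C sol_H0_def by (intro image_eqI[where x = f]) (simp_all only: iff mem_Collect_eq)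
    qed
  qed
qed

lemma inv_sol_U_power_L2_sub:
  "(inv_into (L2 P) (sol_U \<sigma> W P) ^^ n) ` L2_sub P (coord_algebra \<sigma> 0) = L2_sub P (coord_algebra \<sigma> n)"
proof (induction n)
  case (Suc n)
  then show ?case
    by (simp only: funpow.simps image_comp[symmetric] inv_sol_U_L2_sub)
qed simp

end


section \<open>The solenoid measure\<close>

lemma nested_measurable_nonneg:
  assumes "transfer_operator \<sigma> R" and "h \<in> borel_measurable borel" and "\<forall>x. 0 \<le> h x"
    and "\<And>k. k \<le> n \<Longrightarrow> f k \<in> borel_measurable borel \<and> (\<forall>x. 0 \<le> f k x)"
  shows "nested R h n f \<in> borel_measurable borel \<and> (\<forall>x. 0 \<le> nested R h n f x)"
  using assms(4)
proof (induction n arbitrary: f)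
  case 0
  then show ?case using assms(2,3) by auto
next
  case (Suc n)
  let ?N = "nested R h n (\<lambda>k. f (Suc k))"
  have "?N \<in> borel_measurable borel \<and> (\<forall>x. 0 \<le> ?N x)"
    using Suc.prems by (intro Suc.IH) simp
  then have "R ?N \<in> borel_measurable borel" "\<forall>x. 0 \<le> R ?N x"
    using assms(1) by (auto simp: transfer_operator_def)
  moreover have "f 0 \<in> borel_measurable borel" "\<forall>x. 0 \<le> f 0 x"
    using Suc.prems by auto
  ultimately show ?case by auto
qed

lemma nested_scale_head:
  "nested R h n (\<lambda>k. if k = 0 then (\<lambda>x. c x * f 0 x) else f k) x = c x * nested R h n f x"
  by (cases n) (simp_all add: mult.assoc)

text \<open>One step of the shift costs one application of \<open>R\<close>: the outermost \<open>R\<close> in the formula for the law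
  of \<open>x\<^sub>m\<^sub>+\<^sub>1\<close> is integrated against \<open>\<lambda>\<close>, hence can be replaced by the density \<open>W\<close>, and what remains
  is the formula for the law of \<open>x\<^sub>m\<close> with \<open>W\<close> as an extra factor at \<open>x\<^sub>0\<close>.\<close>

lemma solenoid_measure_coord_law:
  assumes R: "transfer_operator \<sigma> R" and h: "h \<in> borel_measurable borel" "\<forall>x. 0 \<le> h x"
    and lam: "sets lam = sets borel"
    and \<nu>: "is_measure_transfer lam R (density lam (\<lambda>x. ennreal (W x)))"
    and W: "W \<in> borel_measurable borel" "\<forall>x. 0 \<le> W x"
    and P: "is_solenoid_measure \<sigma> R h lam P" and A: "A \<in> sets borel"
  shows "(\<integral>\<^sup>+x. indicator A (x (Suc m)) \<partial>P) = (\<integral>\<^sup>+x. ennreal (W (x 0)) * indicator A (x m) \<partial>P)"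
proof -
  \<comment> \<open>\<open>g\<close> is \<open>f\<close> moved one coordinate further, and \<open>fW\<close> is \<open>f\<close> with the weight attached at \<open>x\<^sub>0\<close>.\<close>
  define f :: "nat \<Rightarrow> 'a \<Rightarrow> real" where "f k = (if k = m then indicator A else (\<lambda>_. 1))" for k
  define g where "g k = (if k = 0 then (\<lambda>_. 1) else f (k - 1))" for k
  define fW where "fW = (\<lambda>k. if k = 0 then (\<lambda>x. W x * f 0 x) else f k)"
  have f: "f k \<in> borel_measurable borel \<and> (\<forall>x. 0 \<le> f k x)" for k
    using A by (simp add: f_def)
  then have g: "g k \<in> borel_measurable borel \<and> (\<forall>x. 0 \<le> g k x)" for k
    by (simp add: g_def)
  have fW: "fW k \<in> borel_measurable borel \<and> (\<forall>x. 0 \<le> fW k x)" for k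
  proof -
    have "(\<lambda>x. W x * f 0 x) \<in> borel_measurable borel"
      using W(1) f[of 0] by (intro borel_measurable_times) simp_all
    then show ?thesis
      using f W(2) by (auto simp: fW_def)
  qed
  have law: "(\<integral>\<^sup>+x. ennreal (\<Prod>k\<le>n. u k (x k)) \<partial>P) = (\<integral>\<^sup>+x. ennreal (nested R h n u x) \<partial>lam)"
    if "\<And>k. u k \<in> borel_measurable borel \<and> (\<forall>x. 0 \<le> u k x)" for n u
    using P that by (auto simp: is_solenoid_measure_def)
  let ?N = "nested R h m f"
  have N: "?N \<in> borel_measurable borel" "\<forall>x. 0 \<le> ?N x"
    using nested_measurable_nonneg[OF R h, of m f] f by auto
  have prod_f: "(\<Prod>k\<le>m. f k (x k)) = indicator A (x m)" for x
  proof -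
    have "(\<Prod>k\<le>m. f k (x k)) = (\<Prod>k\<le>m. if k = m then indicator A (x m) else 1)"
      by (intro prod.cong) (auto simp: f_def)
    then show ?thesis by simp
  qed
  have prod_g: "(\<Prod>k\<le>Suc m. g k (x k)) = indicator A (x (Suc m))" for x
    unfolding prod.atMost_Suc_shift using prod_f[of "\<lambda>k. x (Suc k)"] by (simp add: g_def)
  have prod_fW: "(\<Prod>k\<le>m. fW k (x k)) = W (x 0) * indicator A (x m)" for x
  proof -
    have "(\<Prod>k\<le>m. fW k (x k)) = W (x 0) * (\<Prod>k\<le>m. f k (x k))"
      by (cases m) (simp_all add: fW_def prod.atMost_Suc_shift del: prod.atMost_Suc)
    then show ?thesis by (simp add: prod_f)
  qed
  have "(\<integral>\<^sup>+x. indicator A (x (Suc m)) \<partial>P) = (\<integral>\<^sup>+x. ennreal (\<Prod>k\<le>Suc m. g k (x k)) \<partial>P)"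
    by (simp only: prod_g ennreal_indicator)
  also have "\<dots> = (\<integral>\<^sup>+x. ennreal (nested R h (Suc m) g x) \<partial>lam)"
    by (rule law) (rule g)
  also have "\<dots> = (\<integral>\<^sup>+x. ennreal (R ?N x) \<partial>lam)"
    by (simp add: g_def)
  also have "\<dots> = (\<integral>\<^sup>+x. ennreal (?N x) \<partial>density lam (\<lambda>x. ennreal (W x)))"
    using \<nu> N by (simp add: is_measure_transfer_def)
  also have "\<dots> = (\<integral>\<^sup>+x. ennreal (W x) * ennreal (?N x) \<partial>lam)"
    using N(1) W(1) lam by (intro nn_integral_density) (simp_all add: measurable_cong_sets[OF lam refl])
  also have "\<dots> = (\<integral>\<^sup>+x. ennreal (nested R h m fW x) \<partial>lam)"
    using W(2) N(2) by (simp add: fW_def nested_scale_head ennreal_mult)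
  also have "\<dots> = (\<integral>\<^sup>+x. ennreal (\<Prod>k\<le>m. fW k (x k)) \<partial>P)"
    by (rule law[symmetric]) (rule fW)
  also have "\<dots> = (\<integral>\<^sup>+x. ennreal (W (x 0)) * indicator A (x m) \<partial>P)"
    using W(2) by (simp add: prod_fW ennreal_mult ennreal_indicator)
  finally show ?thesis .
qed

text \<open>The preimage of \<open>{x\<^sub>m\<^sub>+\<^sub>1 \<in> A}\<close> under \<^term>\<open>sol_map \<sigma>\<close> is \<open>{x\<^sub>m \<in> A}\<close>, so the previous lemma
  gives equality of the two measures on the cylinders of all coordinates but the first.\<close>

lemma solenoid_measure_invariant:
  assumes R: "transfer_operator \<sigma> R" and h: "h \<in> borel_measurable borel" "\<forall>x. 0 \<le> h x"
    and \<sigma> [measurable]: "\<sigma> \<in> borel \<rightarrow>\<^sub>M borel" and lam: "sets lam = sets borel"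
    and \<nu>: "is_measure_transfer lam R (density lam (\<lambda>x. ennreal (W x)))"
    and W [measurable]: "W \<in> borel_measurable borel" and W_nonneg: "\<forall>x. 0 \<le> W x"
    and P: "is_solenoid_measure \<sigma> R h lam P"
  shows "distr (density P (\<lambda>x. ennreal (W (x 0)))) P (sol_map \<sigma>) = P"
proof (rule cylinder_measure_eqI[OF \<sigma>, symmetric])
  have space: "space P = solenoid \<sigma>" and sets: "sets P = sets (cylinder_algebra \<sigma>)"
    and "prob_space P"
    using P by (auto simp: is_solenoid_measure_def)
  then show "sets P = sets (cylinder_algebra \<sigma>)" "finite_measure P"
      "sets (distr (density P (\<lambda>x. ennreal (W (x 0)))) P (sol_map \<sigma>)) = sets (cylinder_algebra \<sigma>)"
    by (auto simp: prob_space_def)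
  have coord [measurable]: "(\<lambda>x. x k) \<in> P \<rightarrow>\<^sub>M borel" for k
    using measurable_coord measurable_cong_sets[OF sets refl] by blast
  have [measurable]: "sol_map \<sigma> \<in> P \<rightarrow>\<^sub>M P"
    using measurable_sol_map[OF \<sigma>] measurable_cong_sets[OF sets sets] by blast
  note law = solenoid_measure_coord_law[OF R h lam \<nu> W W_nonneg P]
  let ?Q = "distr (density P (\<lambda>x. ennreal (W (x 0)))) P (sol_map \<sigma>)"
  have *: "emeasure P ((\<lambda>x. x (Suc m)) -` A \<inter> solenoid \<sigma>)
      = emeasure ?Q ((\<lambda>x. x (Suc m)) -` A \<inter> solenoid \<sigma>)"
    if [measurable]: "A \<in> sets borel" for m A
  proof -
    let ?C = "(\<lambda>x. x (Suc m)) -` A \<inter> solenoid \<sigma>"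
    have C [measurable]: "?C \<in> sets P"
      using measurable_sets[OF coord that, of "Suc m"] by (simp add: space)
    have "emeasure P ?C = (\<integral>\<^sup>+x. indicator ?C x \<partial>P)"
      by simp
    also have "\<dots> = (\<integral>\<^sup>+x. indicator A (x (Suc m)) \<partial>P)"
      by (intro nn_integral_cong) (auto simp: space indicator_def)
    also have "\<dots> = (\<integral>\<^sup>+x. ennreal (W (x 0)) * indicator A (x m) \<partial>P)"
      by (rule law) fact
    also have "\<dots> = (\<integral>\<^sup>+x. ennreal (W (x 0)) * indicator ?C (sol_map \<sigma> x) \<partial>P)"
      by (intro nn_integral_cong)
        (auto simp: space indicator_def sol_map_Suc sol_map_in_solenoid)
    also have "\<dots> = (\<integral>\<^sup>+x. indicator ?C (sol_map \<sigma> x) \<partial>density P (\<lambda>x. ennreal (W (x 0))))"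
      by (rule nn_integral_density[symmetric]) measurable
    also have "\<dots> = (\<integral>\<^sup>+x. indicator ?C x \<partial>?Q)"
      by (rule nn_integral_distr[symmetric]) measurable
    also have "\<dots> = emeasure ?Q ?C"
      by simp
    finally show ?thesis .
  qed
  show "emeasure P ((\<lambda>x. x k) -` A \<inter> solenoid \<sigma>) = emeasure ?Q ((\<lambda>x. x k) -` A \<inter> solenoid \<sigma>)"
    if A: "A \<in> sets borel" for k A
  proof (cases k)
    case (Suc m)
    with *[OF A] show ?thesis by simp
  next
    case 0
    \<comment> \<open>A condition on \<open>x\<^sub>0\<close> is a condition on \<open>x\<^sub>1\<close>.\<close>
    have "(\<lambda>x. x 0) -` A \<inter> solenoid \<sigma> = (\<lambda>x. x (Suc 0)) -` (\<sigma> -` A) \<inter> solenoid \<sigma>"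
      by (auto simp: solenoid_def)
    moreover have "\<sigma> -` A \<in> sets borel"
      using measurable_sets[OF \<sigma> A] by simp
    ultimately show ?thesis using *[of "\<sigma> -` A" 0] 0 by simp
  qed
qed

lemma solenoid_measure_law_0:
  assumes h: "h \<in> borel_measurable borel" "\<forall>x. 0 \<le> h x" and lam: "sets lam = sets borel"
    and P: "is_solenoid_measure \<sigma> R h lam P"
  shows "distr P borel (\<lambda>x. x 0) = density lam (\<lambda>x. ennreal (h x))"
proof (rule measure_eqI)
  show "sets (distr P borel (\<lambda>x. x 0)) = sets (density lam (\<lambda>x. ennreal (h x)))"
    by (simp add: lam)
  fix A assume "A \<in> sets (distr P borel (\<lambda>x. x 0))"
  then have A [measurable]: "A \<in> sets borel" by simp
  have sets: "sets P = sets (cylinder_algebra \<sigma>)"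
    using P by (simp add: is_solenoid_measure_def)
  have coord: "(\<lambda>x. x 0) \<in> P \<rightarrow>\<^sub>M borel"
    using measurable_coord measurable_cong_sets[OF sets refl] by blast
  have [measurable]: "h \<in> borel_measurable lam" "A \<in> sets lam"
    using h(1) lam A by (simp_all add: measurable_cong_sets[OF lam refl])
  have "emeasure (distr P borel (\<lambda>x. x 0)) A = (\<integral>\<^sup>+x. indicator A x \<partial>distr P borel (\<lambda>x. x 0))"
    by simp
  also have "\<dots> = (\<integral>\<^sup>+x. indicator A (x 0) \<partial>P)"
    by (rule nn_integral_distr) (simp_all add: coord A)
  also have "\<dots> = (\<integral>\<^sup>+x. ennreal (\<Prod>k\<le>0. indicator A (x k)) \<partial>P)"
    by (simp add: ennreal_indicator)
  also have "\<dots> = (\<integral>\<^sup>+x. ennreal (nested R h 0 (\<lambda>_. indicator A) x) \<partial>lam)"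
    using P unfolding is_solenoid_measure_def
    by (auto dest!: spec[of _ 0] spec[of _ "\<lambda>_. indicator A"])
  also have "\<dots> = (\<integral>\<^sup>+x. ennreal (h x) * indicator A x \<partial>lam)"
    using h(2) by (intro nn_integral_cong) (simp add: indicator_def)
  also have "\<dots> = emeasure (density lam (\<lambda>x. ennreal (h x))) A"
    by (rule emeasure_density[symmetric]) measurable
  finally show "emeasure (distr P borel (\<lambda>x. x 0)) A = emeasure (density lam (\<lambda>x. ennreal (h x))) A" .
qed

text \<open>The probability that \<open>x\<^sub>1\<close> lies in the zero set \<open>Z\<close> of \<open>W\<close> is the integral of \<open>W(x\<^sub>0)\<close> over the
  event that \<open>x\<^sub>0\<close> lies in \<open>Z\<close>, which is zero. Absolute continuity of the law of \<open>x\<^sub>0\<close> with respect to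
  that of \<open>x\<^sub>1\<close> carries this over to \<open>x\<^sub>0\<close>.\<close>

lemma solenoid_measure_weight_pos:
  assumes P: "sets P = sets (cylinder_algebra \<sigma>)"
    and W [measurable]: "W \<in> borel_measurable borel" and W_nonneg: "\<forall>x. 0 \<le> W x"
    and law: "\<And>A. A \<in> sets borel \<Longrightarrow>
      (\<integral>\<^sup>+x. indicator A (x 1) \<partial>P) = (\<integral>\<^sup>+x. ennreal (W (x 0)) * indicator A (x 0) \<partial>P)"
    and ac: "absolutely_continuous (distr P borel (\<lambda>x. x 1)) (distr P borel (\<lambda>x. x 0))"
  shows "AE x in P. 0 < W (x 0)"
proof -
  have coord [measurable]: "(\<lambda>x. x k) \<in> P \<rightarrow>\<^sub>M borel" for k
    using measurable_coord measurable_cong_sets[OF P refl] by blast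
  let ?Z = "{y. W y = 0}"
  have Z [measurable]: "?Z \<in> sets borel" by measurable
  have "emeasure (distr P borel (\<lambda>x. x 1)) ?Z = (\<integral>\<^sup>+x. indicator ?Z x \<partial>distr P borel (\<lambda>x. x 1))"
    by simp
  also have "\<dots> = (\<integral>\<^sup>+x. indicator ?Z (x 1) \<partial>P)"
    by (rule nn_integral_distr) (simp_all add: coord Z)
  also have "\<dots> = (\<integral>\<^sup>+x. ennreal (W (x 0)) * indicator ?Z (x 0) \<partial>P)"
    by (rule law) (rule Z)
  also have "\<dots> = (\<integral>\<^sup>+x. 0 \<partial>P)"
    by (intro nn_integral_cong) (auto simp: indicator_def)
  finally have "?Z \<in> null_sets (distr P borel (\<lambda>x. x 1))"
    by (auto intro: null_setsI)
  then have "?Z \<in> null_sets (distr P borel (\<lambda>x. x 0))"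
    using ac by (auto simp: absolutely_continuous_def)
  then have "AE y in distr P borel (\<lambda>x. x 0). y \<notin> ?Z"
    by (rule AE_not_in)
  then have "AE x in P. W (x 0) \<noteq> 0"
    by (subst (asm) AE_distr_iff) auto
  then show ?thesis
    by eventually_elim (use W_nonneg in \<open>auto simp: less_le\<close>)
qed

theorem proposition3p24:
  fixes \<sigma> :: "'a :: t2_space \<Rightarrow> 'a"
    and R :: "('a \<Rightarrow> real) \<Rightarrow> ('a \<Rightarrow> real)"
    and lam \<nu> :: "'a measure"
    and h W :: "'a \<Rightarrow> real"
    and P :: "(nat \<Rightarrow> 'a) measure"
    and n :: nat
  assumes "locally_compact_space (euclidean :: 'a topology)"
    and "\<sigma> \<in> borel \<rightarrow>\<^sub>M borel" and "surj \<sigma>"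
    and "transfer_operator \<sigma> R"
    and "prob_space lam" and "sets lam = sets borel"
    and "h \<in> borel_measurable borel" and "\<forall>x. 0 \<le> h x"
    and "R h = h" and "(\<integral>x. h x \<partial>lam) = 1"
    and "is_measure_transfer lam R \<nu>" and "absolutely_continuous lam \<nu>"
    and "W \<in> borel_measurable borel" and "\<forall>x. 0 \<le> W x"
    and "\<nu> = density lam (\<lambda>x. ennreal (W x))"
    and "is_solenoid_measure \<sigma> R h lam P"
    and "absolutely_continuous (distr P borel (\<lambda>x. x 0)) (distr P borel (\<lambda>x. x 1))"
    and "absolutely_continuous (distr P borel (\<lambda>x. x 1)) (distr P borel (\<lambda>x. x 0))"
  shows "sol_H \<sigma> W h lam P n = L2_sub P (coord_algebra \<sigma> n)
    \<and> L2_sub P (coord_algebra \<sigma> n) = cond_exp_L2 P (coord_algebra \<sigma> n) ` L2 P"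
proof -
  note R = assms(4) and lam = assms(6) and h = assms(7,8) and W = assms(13,14) and P = assms(16)
  note \<nu> = assms(11)[unfolded assms(15)]
  have sets: "sets P = sets (cylinder_algebra \<sigma>)" and "prob_space P"
    using P by (auto simp: is_solenoid_measure_def)
  interpret weighted_shift P \<sigma> W
  proof (intro weighted_shift.intro weighted_shift_axioms.intro)
    show "distr (density P (\<lambda>x. ennreal (W (x 0)))) P (sol_map \<sigma>) = P"
      by (rule solenoid_measure_invariant[OF R h assms(2) lam \<nu> W P])
    show "AE x in P. 0 < W (x 0)"
      using solenoid_measure_coord_law[OF R h lam \<nu> W P, where m = 0]
      by (intro solenoid_measure_weight_pos[OF sets W _ assms(18)]) simp
  qed (use assms(2,3) W sets \<open>prob_space P\<close> in auto)
  have "sol_H0 h lam P = L2_sub P (coord_algebra \<sigma> 0)"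
    using h lam solenoid_measure_law_0[OF h lam P] by (intro sol_H0_eq_L2_sub)
  then show ?thesis
    using inv_sol_U_power_L2_sub cond_exp_L2_image[OF finite_subalgebra_coord_algebra]
    by (simp add: sol_H_def)
qed

end
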